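(* There is an absolute constant $C \geq 1$ such that the following holds. Let $0 < \delta < 1$, let $P \subset Q_{0} = [-1,1]^{2}$ be a finite $\delta$-separated set of points, and let $\mathcal{L} \subset \mathcal{Q}_{0}$ be a finite $\delta$-separated family of lines. Then $$|\mathcal{I}_{\delta}(P,\mathcal{L})| \leq C\, |P|^{2/3}|\mathcal{L}|^{2/3} \cdot \delta^{-1/3},$$ where $|\cdot|$ denotes cardinality on both sides.
   Context: $Q_{0} := [-1,1]^{2} \subset \mathbb{R}^{2}$. For $(a,b) \in \mathbb{R}^2$ let $\ell_{(a,b)} := \{(x,y) \in \mathbb{R}^{2} : y = ax+b\}$, and let $\mathcal{Q}_{0} := \{\ell_{(a,b)} : |a| \leq 1, |b| \leq 1\}$, equipped with the metric $d(\ell_{(a,b)},\ell_{(c,d)}) := |(a,b)-(c,d)|$ (Euclidean norm). A set of points is $\delta$-separated if any two distinct points $p,q$ in it satisfy $|p-q| \geq \delta$; a family of lines in $\mathcal{Q}_{0}$ is $\delta$-separated if any two distinct lines $\ell_1,\ell_2$ in it satisfy $d(\ell_1,\ell_2) \geq \delta$. A point $p \in \mathbb{R}^{2}$ is $\delta$-incident to a line $\ell \subset \mathbb{R}^2$ if $p$ lies in the $\delta$-neighbourhood $\ell(\delta) := \{q \in \mathbb{R}^{2} : \operatorname{dist}(q,\ell) \leq \delta\}$. Finally $\mathcal{I}_{\delta}(P,\mathcal{L}) := \{(p,\ell) \in P \times \mathcal{L} : p \text{ is } \delta\text{-incident to } \ell\}$. *)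

theory Defs
  imports "HOL-Analysis.Analysis"
begin

text \<open>
  The plane is \<^typ>\<open>real \<times> real\<close>, whose library norm and distance are the Euclidean ones
  (see \<open>norm_Pair\<close>, \<open>dist_Pair_Pair\<close>). Lines are honest subsets of the plane.
\<close>

definition Q0 :: "(real \<times> real) set" where
  "Q0 = {-1..1} \<times> {-1..1}"

definition line :: "real \<times> real \<Rightarrow> (real \<times> real) set" where
  "line = (\<lambda>(a, b). {(x, y). y = a * x + b})"

definition lines0 :: "(real \<times> real) set set" where
  "lines0 = {line (a, b) | a b. \<bar>a\<bar> \<le> 1 \<and> \<bar>b\<bar> \<le> 1}"

lemma inj_line: "inj line"
proof (rule injI, clarify)
  fix a b c d :: real
  assume eq: "line (a, b) = line (c, d)"
  have "(0, b) \<in> line (a, b)" "(1, a + b) \<in> line (a, b)"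
    by (simp_all add: line_def)
  with eq have "(0, b) \<in> line (c, d)" "(1, a + b) \<in> line (c, d)"
    by simp_all
  then show "a = c \<and> b = d"
    by (simp add: line_def)
qed

text \<open>
  The distance between non-vertical lines is the Euclidean distance of their parameters, which
  are unique by \<open>inj_line\<close>. The value is unspecified for sets that are not such lines.
\<close>

definition line_dist :: "(real \<times> real) set \<Rightarrow> (real \<times> real) set \<Rightarrow> real" where
  "line_dist l m = dist (inv line l) (inv line m)"

lemma line_dist_line [simp]: "line_dist (line p) (line q) = dist p q"
  by (simp add: line_dist_def inj_line)

definition separated :: "('a \<Rightarrow> 'a \<Rightarrow> real) \<Rightarrow> real \<Rightarrow> 'a set \<Rightarrow> bool" where
  "separated d \<delta> S \<longleftrightarrow> (\<forall>x\<in>S. \<forall>y\<in>S. x \<noteq> y \<longrightarrow> d x y \<ge> \<delta>)"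

definition nbhd :: "real \<Rightarrow> (real \<times> real) set \<Rightarrow> (real \<times> real) set" where
  "nbhd \<delta> l = {q. infdist q l \<le> \<delta>}"

definition incidences ::
  "real \<Rightarrow> (real \<times> real) set \<Rightarrow> (real \<times> real) set set \<Rightarrow> ((real \<times> real) \<times> (real \<times> real) set) set" where
  "incidences \<delta> P L = {(p, l) \<in> P \<times> L. p \<in> nbhd \<delta> l}"

end

theory Submission
  imports Defs
begin

text \<open>
  The proof is a combinatorial form of the restricted \<open>L^(3/2) \<rightarrow> L^3\<close> estimate for the X-ray
  transform. Let \<open>I\<close> be the number of incidences, and discard the lines with fewer than
  \<open>\<alpha> = I / (2|L|)\<close> incident points, which destroys at most half of the incidences. Some point
  \<open>p\<^sub>0\<close> is then incident to at least \<open>\<beta> = I / (2|P|)\<close> of the remaining lines. At most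
  \<open>O(1 + \<rho>/\<delta>)\<close> points incident to a given line lie within \<open>\<rho>\<close> of \<open>p\<^sub>0\<close>, so for \<open>\<alpha>\<close> large and
  \<open>\<rho> = c\<alpha>\<delta>\<close> each of these lines has at least \<open>\<alpha>/2\<close> points at distance \<open>\<ge> \<rho>\<close> from \<open>p\<^sub>0\<close>; and each such
  point shares only \<open>O(1/\<rho>)\<close> lines with \<open>p\<^sub>0\<close>. Hence \<open>\<alpha>\<beta>/2 \<le> O(|P|/\<rho>)\<close>, which is the claim.
  If \<open>\<alpha>\<close> is bounded, then \<open>I \<le> O(|L|)\<close> together with the trivial bound \<open>I \<le> O(|P|/\<delta>)\<close> suffices.
\<close>

section \<open>Grid counting for separated sets\<close>

text \<open>A half-open square cell of side \<eta> in the \<open>(f, g)\<close> coordinates contains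
  at most one element, so it suffices to count cells. Leaving \<open>f\<close> and \<open>g\<close>
  free admits sheared coordinates, for points and for line parameters alike.\<close>

lemma card_separated_le_grid:
  fixes f g :: "'a \<Rightarrow> real"
  assumes "\<eta> > 0" "A \<ge> 0" "B \<ge> 0"
    and f: "\<And>s. s \<in> S \<Longrightarrow> \<bar>f s - u\<bar> \<le> A"
    and g: "\<And>s. s \<in> S \<Longrightarrow> \<bar>g s - v\<bar> \<le> B"
    and sep: "\<And>s t. s \<in> S \<Longrightarrow> t \<in> S \<Longrightarrow> s \<noteq> t \<Longrightarrow> \<bar>f s - f t\<bar> \<ge> \<eta> \<or> \<bar>g s - g t\<bar> \<ge> \<eta>"
  shows "real (card S) \<le> (2 * A / \<eta> + 1) * (2 * B / \<eta> + 1)"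
proof -
  define cell where "cell = (\<lambda>s. (\<lfloor>(f s - u + A) / \<eta>\<rfloor>, \<lfloor>(g s - v + B) / \<eta>\<rfloor>))"
  define G where "G = {0..\<lfloor>2 * A / \<eta>\<rfloor>} \<times> {0..\<lfloor>2 * B / \<eta>\<rfloor>}"
  have same_floor: "\<bar>x - y\<bar> < \<eta>" if "\<lfloor>(x + c) / \<eta>\<rfloor> = \<lfloor>(y + c) / \<eta>\<rfloor>" for x y c :: real
  proof -
    have "\<bar>(x + c) / \<eta> - (y + c) / \<eta>\<bar> < 1" using that by linarith
    also have "(x + c) / \<eta> - (y + c) / \<eta> = (x - y) / \<eta>"
      by (simp add: diff_divide_distrib add_divide_distrib)
    finally show ?thesis using \<open>\<eta> > 0\<close> by (simp add: abs_divide field_simps)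
  qed
  have "inj_on cell S"
  proof (rule inj_onI, rule ccontr)
    fix s t assume st: "s \<in> S" "t \<in> S" "cell s = cell t" "s \<noteq> t"
    have "\<bar>f s - f t\<bar> < \<eta>" "\<bar>g s - g t\<bar> < \<eta>"
      using same_floor[of "f s" "A - u" "f t"] same_floor[of "g s" "B - v" "g t"] st(3)
      by (simp_all add: cell_def algebra_simps)
    with sep[OF st(1,2,4)] show False by linarith
  qed
  moreover have "cell ` S \<subseteq> G"
  proof (rule image_subsetI)
    fix s assume "s \<in> S"
    have "0 \<le> f s - u + A" "f s - u + A \<le> 2 * A" "0 \<le> g s - v + B" "g s - v + B \<le> 2 * B"
      using f[OF \<open>s \<in> S\<close>] g[OF \<open>s \<in> S\<close>] by linarith+
    then show "cell s \<in> G"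
      using \<open>\<eta> > 0\<close> by (auto simp: cell_def G_def intro!: floor_mono divide_right_mono)
  qed
  moreover have "finite G" by (simp add: G_def)
  ultimately have "card S \<le> card G" by (metis card_inj_on_le)
  then have "real (card S) \<le> real (card G)" by simp
  also have "\<dots> = (real_of_int \<lfloor>2 * A / \<eta>\<rfloor> + 1) * (real_of_int \<lfloor>2 * B / \<eta>\<rfloor> + 1)"
    using assms(1-3) by (simp add: G_def card_cartesian_product)
  also have "\<dots> \<le> (2 * A / \<eta> + 1) * (2 * B / \<eta> + 1)"
    using assms(1-3) by (intro mult_mono add_right_mono of_int_floor_le) auto
  finally show ?thesis .
qed

lemma abs_fst_le_1: "p \<in> Q0 \<Longrightarrow> \<bar>fst p\<bar> \<le> 1"
  by (auto simp: Q0_def)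

text \<open>A shear with |c| \<le> 1 shrinks distances only boundedly: if both sheared differences
  were below \<delta>/4, the vertical one would be below \<delta>/2 and the distance below
  3\<delta>/4.\<close>

lemma coordinates_far:
  fixes p q :: "real \<times> real"
  assumes "\<delta> \<le> dist p q" "\<delta> > 0" "\<bar>c\<bar> \<le> 1"
  shows "\<delta>/4 \<le> \<bar>fst p - fst q\<bar> \<or> \<delta>/4 \<le> \<bar>(snd p - c * fst p) - (snd q - c * fst q)\<bar>"
proof (rule ccontr)
  assume "\<not> ?thesis"
  then have x: "\<bar>fst p - fst q\<bar> < \<delta>/4" and r: "\<bar>(snd p - snd q) - c * (fst p - fst q)\<bar> < \<delta>/4"
    by (simp_all add: algebra_simps)
  define e where "e = c * (fst p - fst q)"
  have "\<bar>e\<bar> \<le> 1 * \<bar>fst p - fst q\<bar>"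
    unfolding e_def abs_mult using assms(3) by (intro mult_right_mono) auto
  moreover have "dist p q \<le> \<bar>fst p - fst q\<bar> + \<bar>snd p - snd q\<bar>"
    using sqrt_sum_squares_le_sum_abs by (simp add: dist_prod_def dist_real_def)
  ultimately show False using x r[folded e_def] assms(1,2) by argo
qed

text \<open>
  Lines are represented by their parameters \<open>(a, b)\<close>. Passing from Euclidean to vertical distance
  costs a factor \<open>\<surd>(1 + a\<^sup>2) \<le> 2\<close>.
\<close>

definition near :: "real \<Rightarrow> real \<times> real \<Rightarrow> real \<times> real \<Rightarrow> bool" where
  "near \<delta> p m \<longleftrightarrow> \<bar>snd p - fst m * fst p - snd m\<bar> \<le> 2 * \<delta>"

lemma nbhd_line_imp_near:
  assumes "p \<in> nbhd \<delta> (line m)" "\<bar>fst m\<bar> \<le> 1"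
  shows "near \<delta> p m"
proof -
  obtain a b where m: "m = (a, b)" by fastforce
  \<comment> \<open>\<open>infdist\<close> to the empty set is 0 by definition, so a pointwise lower
    bound passes to it only for a nonempty line.\<close>
  have ne: "line m \<noteq> {}" by (auto simp: line_def m)
  have "\<bar>snd p - a * fst p - b\<bar> / 2 \<le> dist p q" if "q \<in> line m" for q
  proof -
    have q: "snd q = a * fst q + b" using that by (auto simp: line_def m)
    define e where "e = a * (fst p - fst q)"
    have "\<bar>e\<bar> \<le> 1 * \<bar>fst p - fst q\<bar>"
      unfolding e_def abs_mult using assms(2) m by (intro mult_right_mono) auto
    moreover have "snd p - a * fst p - b = (snd p - snd q) - e"
      using q by (simp add: e_def algebra_simps)
    moreover have "\<bar>fst p - fst q\<bar> \<le> dist p q" "\<bar>snd p - snd q\<bar> \<le> dist p q"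
      using dist_fst_le[of p q] dist_snd_le[of p q] by (simp_all add: dist_real_def)
    ultimately show ?thesis by argo
  qed
  then have "\<bar>snd p - a * fst p - b\<bar> / 2 \<le> infdist p (line m)"
    unfolding infdist_notempty[OF ne] by (intro cINF_greatest[OF ne])
  then show ?thesis using assms(1) m by (simp add: nbhd_def near_def)
qed

section \<open>Counts of points near a line and of lines near one or two points\<close>

text \<open>Shearing along the line turns the strip into a box with half-widths \<rho> and
  2\<delta>; a grid of mesh \<delta>/4 has at most 17 rows there.\<close>

lemma card_points_near_line:
  assumes "0 < \<delta>" "separated dist \<delta> P" "\<bar>fst m\<bar> \<le> 1" "\<rho> \<ge> 0"
  shows "real (card {p \<in> P. near \<delta> p m \<and> dist p p0 < \<rho>}) \<le> 136 * \<rho> / \<delta> + 17"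
proof -
  let ?S = "{p \<in> P. near \<delta> p m \<and> dist p p0 < \<rho>}"
  have "real (card ?S) \<le> (2 * \<rho> / (\<delta>/4) + 1) * (2 * (2 * \<delta>) / (\<delta>/4) + 1)"
  proof (rule card_separated_le_grid[where f = fst and u = "fst p0" and v = "snd m"
        and g = "\<lambda>p. snd p - fst m * fst p"])
    fix p assume p: "p \<in> ?S"
    show "\<bar>fst p - fst p0\<bar> \<le> \<rho>"
      using dist_fst_le[of p p0] p by (simp add: dist_real_def)
    show "\<bar>snd p - fst m * fst p - snd m\<bar> \<le> 2 * \<delta>"
      using p by (simp add: near_def)
  next
    fix p q assume "p \<in> ?S" "q \<in> ?S" "p \<noteq> q"
    then have "\<delta> \<le> dist p q" using assms(2) by (auto simp: separated_def)
    then show "\<delta>/4 \<le> \<bar>fst p - fst q\<bar> \<or>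
        \<delta>/4 \<le> \<bar>snd p - fst m * fst p - (snd q - fst m * fst q)\<bar>"
      using coordinates_far assms by blast
  qed (use assms in auto)
  also have "\<dots> = 136 * \<rho> / \<delta> + 17" using assms(1) by (simp add: field_simps)
  finally show ?thesis .
qed

text \<open>Point-line duality: the parameters of lines near \<open>p\<close> lie in a strip around
  the line of slope \<open>- fst p\<close>, so the same shear and grid apply. A second incident
  point will narrow the slope window \<open>A\<close>.\<close>

lemma card_lines_near_point:
  assumes "0 < \<delta>" "separated dist \<delta> M" "\<bar>fst p\<bar> \<le> 1" "A \<ge> 0"
    and "\<And>m. m \<in> S \<Longrightarrow> m \<in> M \<and> near \<delta> p m \<and> \<bar>fst m - u\<bar> \<le> A"
  shows "real (card S) \<le> (8 * A / \<delta> + 1) * 17"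
proof -
  have "real (card S) \<le> (2 * A / (\<delta>/4) + 1) * (2 * (2 * \<delta>) / (\<delta>/4) + 1)"
  proof (rule card_separated_le_grid[where f = fst and u = u and v = "snd p"
        and g = "\<lambda>m. snd m - (- fst p) * fst m"])
    fix m assume m: "m \<in> S"
    show "\<bar>fst m - u\<bar> \<le> A" using assms(5)[OF m] by simp
    show "\<bar>snd m - (- fst p) * fst m - snd p\<bar> \<le> 2 * \<delta>"
      using assms(5)[OF m] by (simp add: near_def abs_le_iff algebra_simps)
  next
    fix m n assume "m \<in> S" "n \<in> S" "m \<noteq> n"
    then have "\<delta> \<le> dist m n" using assms(2,5) by (auto simp: separated_def)
    then show "\<delta>/4 \<le> \<bar>fst m - fst n\<bar> \<or>
        \<delta>/4 \<le> \<bar>snd m - (- fst p) * fst m - (snd n - (- fst p) * fst n)\<bar>"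
      using coordinates_far[of \<delta> m n "- fst p"] assms by simp
  qed (use assms in auto)
  also have "\<dots> = (8 * A / \<delta> + 1) * 17" using assms(1) by (simp add: field_simps)
  finally show ?thesis .
qed

lemma card_lines_near_point_le:
  assumes "0 < \<delta>" "\<delta> < 1" "separated dist \<delta> M" "M \<subseteq> Q0" "p \<in> Q0"
  shows "real (card {m \<in> M. near \<delta> p m}) \<le> 153 / \<delta>"
proof -
  have "real (card {m \<in> M. near \<delta> p m}) \<le> (8 * 1 / \<delta> + 1) * 17"
    using assms by (intro card_lines_near_point[where u = 0 and p = p and M = M])
      (auto intro: abs_fst_le_1)
  also have "\<dots> \<le> 153 / \<delta>" using assms(1,2) by (simp add: field_simps)
  finally show ?thesis .
qed

lemma dist_Q0_le:
  assumes "p \<in> Q0" "q \<in> Q0"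
  shows "dist p q \<le> 3"
proof -
  have d: "\<bar>fst p - fst q\<bar> \<le> 2" "\<bar>snd p - snd q\<bar> \<le> 2"
    using assms by (auto simp: Q0_def)
  have "(fst p - fst q)\<^sup>2 \<le> 2\<^sup>2" "(snd p - snd q)\<^sup>2 \<le> 2\<^sup>2"
    using d abs_le_square_iff[of _ "2::real"] by simp_all
  then have "(fst p - fst q)\<^sup>2 + (snd p - snd q)\<^sup>2 \<le> 9" by simp
  then show ?thesis
    by (auto simp: dist_prod_def dist_real_def intro!: real_le_lsqrt)
qed

text \<open>
  The slopes are confined to an interval of length \<open>O(\<delta>/t)\<close>: by subtracting the two incidence
  conditions if the points differ substantially in the first coordinate; otherwise \<open>t \<le> 8\<delta>\<close>, and
  \<open>\<bar>a\<bar> \<le> 1\<close> is enough.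
\<close>

lemma card_lines_near_two_points:
  assumes "0 < \<delta>" "separated dist \<delta> M" "M \<subseteq> Q0" "p \<in> Q0" "q \<in> Q0" "p \<noteq> q"
  shows "real (card {m \<in> M. near \<delta> p m \<and> near \<delta> q m}) \<le> 2227 / dist p q"
proof -
  define t where "t = dist p q"
  \<comment> \<open>The slope of the line through \<open>p\<close> and \<open>q\<close>; for nearly
    vertical pairs, 0 serves as centre for all slopes in [-1,1].\<close>
  define u where "u = (if t/4 \<le> \<bar>fst p - fst q\<bar> then (snd p - snd q) / (fst p - fst q) else 0)"
  have t: "0 < t" "t \<le> 3" using assms dist_Q0_le by (auto simp: t_def)
  have slope: "\<bar>fst m - u\<bar> \<le> 16 * \<delta> / t" if m: "m \<in> M" "near \<delta> p m" "near \<delta> q m" for m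
  proof -
    have a: "\<bar>fst m\<bar> \<le> 1" using m(1) assms(3) abs_fst_le_1 by blast
    have 4: "\<bar>(snd p - snd q) - fst m * (fst p - fst q)\<bar> \<le> 4 * \<delta>"
      using m(2,3) unfolding near_def right_diff_distrib by linarith
    show ?thesis
    proof (cases "t/4 \<le> \<bar>fst p - fst q\<bar>")
      case True
      then have x: "fst p - fst q \<noteq> 0" using t by auto
      have "(t/4) * \<bar>fst m - u\<bar> \<le> \<bar>fst p - fst q\<bar> * \<bar>fst m - u\<bar>"
        using True by (intro mult_right_mono) auto
      also have "\<dots> = \<bar>(fst p - fst q) * (fst m - u)\<bar>" by (simp add: abs_mult)
      also have "(fst p - fst q) * (fst m - u) = fst m * (fst p - fst q) - (snd p - snd q)"
      proof -
        have "(fst p - fst q) * u = snd p - snd q" using True x by (simp add: u_def)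
        then show ?thesis by (metis right_diff_distrib mult.commute)
      qed
      also have "\<bar>\<dots>\<bar> \<le> 4 * \<delta>" using 4 by linarith
      finally show ?thesis using t by (simp add: field_simps)
    next
      case False
      have "t \<le> \<bar>fst p - fst q\<bar> + \<bar>snd p - snd q\<bar>"
        using sqrt_sum_squares_le_sum_abs by (simp add: t_def dist_prod_def dist_real_def)
      moreover define e where "e = fst m * (fst p - fst q)"
      have "\<bar>e\<bar> \<le> 1 * \<bar>fst p - fst q\<bar>"
        unfolding e_def abs_mult using a by (intro mult_right_mono) auto
      \<comment> \<open>With dx = \<open>fst p - fst q\<close>, this is t \<le> 2|dx| + 4\<delta> <
        t/2 + 4\<delta>.\<close>
      ultimately have "t \<le> 8 * \<delta>" using 4[folded e_def] False by argo
      then have "1 \<le> 16 * \<delta> / t" using t by (simp add: field_simps)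
      moreover have "u = 0" using False by (simp add: u_def)
      ultimately show ?thesis using a by linarith
    qed
  qed
  have "real (card {m \<in> M. near \<delta> p m \<and> near \<delta> q m}) \<le> (8 * (16 * \<delta> / t) / \<delta> + 1) * 17"
    using assms t slope
    by (intro card_lines_near_point[where u = u and p = p and M = M]) (auto intro: abs_fst_le_1)
  \<comment> \<open>2227 = 17 * 128 + 17 * 3: the bound t \<le> 3 absorbs the constant term into
    1/t.\<close>
  also have "\<dots> \<le> 2227 / t" using t assms(1) by (simp add: field_simps)
  finally show ?thesis by (simp add: t_def)
qed

section \<open>Double counting and the cubed bound\<close>

lemma sum_card_swap:
  assumes "finite A" "finite B"
  shows "(\<Sum>a\<in>A. real (card {b \<in> B. R a b})) = (\<Sum>b\<in>B. real (card {a \<in> A. R a b}))"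
proof -
  have "(\<Sum>a\<in>A. card {b \<in> B. R a b}) = (\<Sum>b\<in>B. card {a \<in> A. R a b})"
    using assms by (intro sum_multicount_gen) auto
  then show ?thesis by (simp flip: of_nat_sum)
qed

text \<open>Two averagings: lines below the threshold carry at most \<open>card M\<close> times it,
  that is I/2; the incidences that remain, at least I/2, are averaged over \<open>P\<close>.\<close>

lemma rich_lines_through_point:
  fixes R :: "'a \<Rightarrow> 'b \<Rightarrow> bool"
  assumes "finite P" "finite M" "P \<noteq> {}" "M \<noteq> {}"
    and I: "I = (\<Sum>p\<in>P. real (card {m \<in> M. R p m}))"
  obtains p0 where "p0 \<in> P"
    "I / (2 * real (card P))
      \<le> real (card {m \<in> M. R p0 m \<and> I / (2 * real (card M)) \<le> real (card {p \<in> P. R p m})})"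
proof -
  define \<alpha> where "\<alpha> = I / (2 * real (card M))"
  define M' where "M' = {m \<in> M. \<alpha> \<le> real (card {p \<in> P. R p m})}"
  have pos: "0 < real (card P)" "0 < real (card M)" using assms by (auto simp: card_gt_0_iff)
  have "I \<ge> 0" by (simp add: I sum_nonneg)
  then have "\<alpha> \<ge> 0" by (simp add: \<alpha>_def)
  have "I = (\<Sum>m\<in>M. real (card {p \<in> P. R p m}))"
    unfolding I using assms(1,2) by (rule sum_card_swap)
  also have "\<dots> = (\<Sum>m\<in>M - M'. real (card {p \<in> P. R p m})) + (\<Sum>m\<in>M'. real (card {p \<in> P. R p m}))"
    using assms(2) by (intro sum.subset_diff) (auto simp: M'_def)
  also have "(\<Sum>m\<in>M - M'. real (card {p \<in> P. R p m})) \<le> real (card (M - M')) * \<alpha>"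
    by (intro sum_bounded_above) (auto simp: M'_def)
  also have "\<dots> \<le> real (card M) * \<alpha>"
    using assms(2) \<open>\<alpha> \<ge> 0\<close> by (intro mult_right_mono) (auto intro: card_mono)
  also have "\<dots> = I / 2" using pos by (simp add: \<alpha>_def)
  also have "(\<Sum>m\<in>M'. real (card {p \<in> P. R p m})) = (\<Sum>p\<in>P. real (card {m \<in> M'. R p m}))"
    using assms(1,2) by (intro sum_card_swap) (auto simp: M'_def)
  finally have half: "I / 2 \<le> (\<Sum>p\<in>P. real (card {m \<in> M'. R p m}))" by simp
  have "\<exists>p\<in>P. I / (2 * real (card P)) \<le> real (card {m \<in> M'. R p m})"
  proof (rule ccontr)
    assume "\<not> ?thesis"
    then have "(\<Sum>p\<in>P. real (card {m \<in> M'. R p m})) < (\<Sum>p\<in>P. I / (2 * real (card P)))"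
      using assms by (intro sum_strict_mono) auto
    also have "\<dots> = I / 2" using pos by simp
    finally show False using half by simp
  qed
  moreover have "{m \<in> M'. R p m} = {m \<in> M. R p m \<and> \<alpha> \<le> real (card {p \<in> P. R p m})}" for p
    by (auto simp: M'_def)
  ultimately show ?thesis using that by (auto simp: \<alpha>_def)
qed

lemma near_count_cube_of_rich:
  assumes \<delta>: "0 < \<delta>"
    and P: "finite P" "P \<subseteq> Q0" "separated dist \<delta> P"
    and M: "finite M" "M \<subseteq> Q0" "separated dist \<delta> M"
    and ne: "P \<noteq> {}" "M \<noteq> {}"
    and I: "I = (\<Sum>p\<in>P. real (card {m \<in> M. near \<delta> p m}))"
    and rich: "136 * real (card M) \<le> I"
  shows "I^3 \<le> 300^3 * (real (card P))\<^sup>2 * (real (card M))\<^sup>2 / \<delta>"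
proof -
  define a where "a = real (card P)"
  define b where "b = real (card M)"
  have pos: "0 < a" "0 < b" using P M ne by (auto simp: a_def b_def card_gt_0_iff)
  define \<alpha> where "\<alpha> = I / (2 * b)"
  define \<beta> where "\<beta> = I / (2 * a)"
  \<comment> \<open>544 = 4 * 136 bounds the points of one line close to \<open>p0\<close> by
    \<alpha>/4 + 17, and 17 \<le> \<alpha>/4 because \<alpha> \<ge> 68. The richness constant 136 =
    2 * 68 is chosen for this.\<close>
  define \<rho> where "\<rho> = \<alpha> * \<delta> / 544"
  have \<alpha>: "68 \<le> \<alpha>" using rich pos by (simp add: \<alpha>_def b_def field_simps)
  have \<beta>: "0 \<le> \<beta>" using rich pos by (simp add: \<beta>_def b_def)
  have \<rho>: "0 < \<rho>" using \<alpha> \<delta> by (simp add: \<rho>_def)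
  obtain p0 where p0: "p0 \<in> P"
    and "\<beta> \<le> real (card {m \<in> M. near \<delta> p0 m \<and> \<alpha> \<le> real (card {p \<in> P. near \<delta> p m})})"
    using rich_lines_through_point[OF P(1) M(1) ne I] by (auto simp: a_def b_def \<alpha>_def \<beta>_def)
  moreover define N where "N = {m \<in> M. near \<delta> p0 m \<and> \<alpha> \<le> real (card {p \<in> P. near \<delta> p m})}"
  ultimately have N: "\<beta> \<le> real (card N)" by simp
  define F where "F = {p \<in> P. \<rho> \<le> dist p p0}"
  have fin: "finite N" "finite F" using M P by (auto simp: N_def F_def)
  have far: "\<alpha> / 2 \<le> real (card {p \<in> F. near \<delta> p m})" if "m \<in> N" for m
  proof -
    have "{p \<in> P. near \<delta> p m} = {p \<in> F. near \<delta> p m} \<union> {p \<in> P. near \<delta> p m \<and> dist p p0 < \<rho>}"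
      by (auto simp: F_def)
    then have "card {p \<in> P. near \<delta> p m}
        \<le> card {p \<in> F. near \<delta> p m} + card {p \<in> P. near \<delta> p m \<and> dist p p0 < \<rho>}"
      by (simp add: card_Un_le)
    moreover have "\<alpha> \<le> real (card {p \<in> P. near \<delta> p m})" using that by (simp add: N_def)
    moreover have "real (card {p \<in> P. near \<delta> p m \<and> dist p p0 < \<rho>}) \<le> 136 * \<rho> / \<delta> + 17"
      using \<delta> P that M \<rho> by (intro card_points_near_line) (auto simp: N_def intro: abs_fst_le_1)
    moreover have "136 * \<rho> / \<delta> = \<alpha> / 4" using \<delta> by (simp add: \<rho>_def)
    ultimately show ?thesis using \<alpha> by linarith
  qed
  have few: "real (card {m \<in> N. near \<delta> p m}) \<le> 2227 / \<rho>" if "p \<in> F" for p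
  proof -
    \<comment> \<open>\<rho> > 0 separates \<open>p\<close> from \<open>p0\<close>, as the two-point
      bound requires.\<close>
    have p: "p \<in> P" "\<rho> \<le> dist p p0" "p \<noteq> p0" using that \<rho> by (auto simp: F_def)
    have "card {m \<in> N. near \<delta> p m} \<le> card {m \<in> M. near \<delta> p m \<and> near \<delta> p0 m}"
      using M by (intro card_mono) (auto simp: N_def)
    also have "real \<dots> \<le> 2227 / dist p p0"
      using \<delta> M P p p0 by (intro card_lines_near_two_points) auto
    also have "\<dots> \<le> 2227 / \<rho>" using p \<rho> by (intro divide_left_mono) auto
    finally show ?thesis by simp
  qed
  have "\<beta> * (\<alpha> / 2) \<le> real (card N) * (\<alpha> / 2)"
    using N \<alpha> by (intro mult_right_mono) auto
  also have "\<dots> \<le> (\<Sum>m\<in>N. real (card {p \<in> F. near \<delta> p m}))"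
    by (intro sum_bounded_below far)
  also have "\<dots> = (\<Sum>p\<in>F. real (card {m \<in> N. near \<delta> p m}))"
    using fin by (rule sum_card_swap)
  also have "\<dots> \<le> real (card F) * (2227 / \<rho>)"
    by (intro sum_bounded_above few)
  also have "\<dots> \<le> a * (2227 / \<rho>)"
    using P \<rho> by (intro mult_right_mono) (auto simp: F_def a_def intro!: card_mono)
  finally have "\<beta> * (\<alpha> / 2) * \<rho> \<le> a * 2227" using \<rho> by (simp add: field_simps)
  \<comment> \<open>The factor 8704 = 16 * 544 together with \<open>a * b\<^sup>2\<close> clears the
    denominators of \<alpha>, \<beta> and \<rho>; 2227 * 8704 stays below 300^3.\<close>
  then have "\<beta> * (\<alpha> / 2) * \<rho> * (8704 * a * b\<^sup>2) \<le> a * 2227 * (8704 * a * b\<^sup>2)"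
    using pos by (intro mult_right_mono) auto
  moreover have "I^3 * \<delta> = \<beta> * (\<alpha> / 2) * \<rho> * (8704 * a * b\<^sup>2)"
    using pos by (simp add: \<alpha>_def \<beta>_def \<rho>_def field_simps power2_eq_square power3_eq_cube)
  ultimately have "I^3 * \<delta> \<le> a * 2227 * (8704 * a * b\<^sup>2)" by simp
  also have "\<dots> = 19383808 * (a\<^sup>2 * b\<^sup>2)" by (simp add: power2_eq_square)
  also have "\<dots> \<le> 300^3 * (a\<^sup>2 * b\<^sup>2)" by (intro mult_right_mono) auto
  finally show ?thesis using \<delta> by (simp add: a_def b_def field_simps)
qed

lemma near_count_cube:
  assumes \<delta>: "0 < \<delta>" "\<delta> < 1"
    and P: "finite P" "P \<subseteq> Q0" "separated dist \<delta> P"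
    and M: "finite M" "M \<subseteq> Q0" "separated dist \<delta> M"
    and I: "I = (\<Sum>p\<in>P. real (card {m \<in> M. near \<delta> p m}))"
  shows "I^3 \<le> 300^3 * (real (card P))\<^sup>2 * (real (card M))\<^sup>2 / \<delta>"
proof (cases "P = {} \<or> M = {}")
  case True
  then have "I = 0" unfolding I by auto
  then show ?thesis using \<delta> by simp
next
  case False
  define a where "a = real (card P)"
  define b where "b = real (card M)"
  have a: "1 \<le> a" using P False by (simp add: a_def Suc_le_eq card_gt_0_iff)
  show ?thesis
  proof (cases "136 * b \<le> I")
    case True
    then show ?thesis
      using near_count_cube_of_rich[OF \<delta>(1) P M _ _ I] False by (simp add: b_def)
  next
    case poor: False
    have "I \<ge> 0" by (simp add: I sum_nonneg)
    have "I \<le> a * (153 / \<delta>)"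
      unfolding I a_def using \<delta> P M
      by (intro sum_bounded_above card_lines_near_point_le) auto
    \<comment> \<open>Squaring the bound by \<open>b\<close> and using the other once gives the
      right powers of \<open>b\<close> and \<delta>; the missing factor \<open>a\<close> is supplied
      by a \<ge> 1.\<close>
    then have "I^2 * I \<le> (136 * b)^2 * (a * (153 / \<delta>))"
      using poor \<open>I \<ge> 0\<close> by (intro mult_mono power_mono) auto
    also have "\<dots> = 2829888 * (a * b\<^sup>2 / \<delta>)" by (simp add: power_mult_distrib)
    also have "\<dots> \<le> 300^3 * (a\<^sup>2 * b\<^sup>2 / \<delta>)"
      using a \<delta> by (intro mult_mono divide_right_mono mult_right_mono self_le_power) auto
    finally show ?thesis by (simp add: a_def b_def power2_eq_square power3_eq_cube)
  qed
qed

section \<open>Transfer from lines to parameters, and the theorem\<close>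

text \<open>Injectivity of \<open>line\<close> keeps the set of parameters finite. Only an
  inequality results, since \<open>near\<close> is implied by membership in \<open>nbhd\<close> but
  not conversely.\<close>

lemma card_incidences_le:
  assumes "finite P" "finite L" "L \<subseteq> lines0"
  shows "real (card (incidences \<delta> P L)) \<le> (\<Sum>p\<in>P. real (card {m \<in> line -` L. near \<delta> p m}))"
proof -
  let ?J = "SIGMA p:P. {m \<in> line -` L. near \<delta> p m}"
  have finM: "finite (line -` L)" using assms(2) inj_line by (rule finite_vimageI)
  then have fin: "finite {m \<in> line -` L. near \<delta> p m}" for p
    by (rule finite_subset[rotated]) auto
  have finJ: "finite ?J" using assms(1) by (intro finite_SigmaI fin)
  have "incidences \<delta> P L \<subseteq> (\<lambda>(p, m). (p, line m)) ` ?J"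
  proof
    fix z assume "z \<in> incidences \<delta> P L"
    then obtain p l where z: "z = (p, l)" "p \<in> P" "l \<in> L" "p \<in> nbhd \<delta> l"
      by (auto simp: incidences_def)
    then obtain a b where l: "l = line (a, b)" "\<bar>a\<bar> \<le> 1" using assms(3) by (auto simp: lines0_def)
    then have "near \<delta> p (a, b)" using z by (intro nbhd_line_imp_near) auto
    then have "(p, (a, b)) \<in> ?J" using z l by simp
    then show "z \<in> (\<lambda>(p, m). (p, line m)) ` ?J" using z l by force
  qed
  then have "card (incidences \<delta> P L) \<le> card ?J"
    using finJ by (meson surj_card_le)
  also have "card ?J = (\<Sum>p\<in>P. card {m \<in> line -` L. near \<delta> p m})"
    using assms(1) by (intro card_SigmaI ballI fin)
  finally show ?thesis by (simp flip: of_nat_sum)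
qed

theorem theorem1p2:
  shows "\<exists>C::real. C \<ge> 1 \<and>
    (\<forall>(\<delta>::real) (P::(real \<times> real) set) (L::(real \<times> real) set set).
       0 < \<delta> \<longrightarrow> \<delta> < 1 \<longrightarrow>
       finite P \<longrightarrow> P \<subseteq> Q0 \<longrightarrow> separated dist \<delta> P \<longrightarrow>
       finite L \<longrightarrow> L \<subseteq> lines0 \<longrightarrow> separated line_dist \<delta> L \<longrightarrow>
       real (card (incidences \<delta> P L))
         \<le> C * real (card P) powr (2/3) * real (card L) powr (2/3) * \<delta> powr (-1/3))"
proof (intro exI[of _ 300] conjI allI impI)
  fix \<delta> :: real and P :: "(real \<times> real) set" and L :: "(real \<times> real) set set"
  assume \<delta>: "0 < \<delta>" "\<delta> < 1"
    and P: "finite P" "P \<subseteq> Q0" "separated dist \<delta> P"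
    and L: "finite L" "L \<subseteq> lines0" "separated line_dist \<delta> L"
  define M where "M = line -` L"
  define I where "I = (\<Sum>p\<in>P. real (card {m \<in> M. near \<delta> p m}))"
  have LM: "L = line ` M" using L(2) by (auto simp: M_def lines0_def)
  have cardL: "card L = card M" unfolding LM by (intro card_image inj_on_subset[OF inj_line]) auto
  have M: "finite M" "M \<subseteq> Q0" "separated dist \<delta> M"
  proof -
    show "finite M" unfolding M_def using L(1) inj_line by (rule finite_vimageI)
    show "M \<subseteq> Q0"
    proof
      fix m assume "m \<in> M"
      then obtain a b where "line m = line (a, b)" "\<bar>a\<bar> \<le> 1" "\<bar>b\<bar> \<le> 1"
        using L(2) by (auto simp: M_def lines0_def)
      then show "m \<in> Q0" by (auto simp: inj_eq[OF inj_line] Q0_def)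
    qed
    show "separated dist \<delta> M"
      unfolding separated_def
    proof (intro ballI impI)
      fix m n assume "m \<in> M" "n \<in> M" "m \<noteq> n"
      then have "line m \<in> L" "line n \<in> L" "line m \<noteq> line n"
        using inj_line by (auto simp: M_def inj_eq)
      then have "\<delta> \<le> line_dist (line m) (line n)"
        using L(3) unfolding separated_def by blast
      then show "\<delta> \<le> dist m n" by simp
    qed
  qed
  \<comment> \<open>The two sides are compared after cubing, which removes the fractional exponents;
    300 is the cube root of the constant in \<open>near_count_cube\<close>.\<close>
  have cube: "(x powr (2/3))^3 = x\<^sup>2" if "x \<ge> 0" for x :: real
    using that by (cases "x = 0") (simp_all add: powr_powr flip: powr_numeral)
  have cube_\<delta>: "(\<delta> powr (-1/3))^3 = 1 / \<delta>"
    using \<delta> by (simp add: powr_powr powr_divide powr_minus_divide flip: powr_numeral)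
  let ?B = "300 * real (card P) powr (2/3) * real (card L) powr (2/3) * \<delta> powr (-1/3)"
  have "I^3 \<le> 300^3 * (real (card P))\<^sup>2 * (real (card M))\<^sup>2 / \<delta>"
    using near_count_cube[OF \<delta> P M] by (simp add: I_def)
  also have "\<dots> = ?B^3"
    unfolding power_mult_distrib cube_\<delta> cardL by (simp add: cube)
  \<comment> \<open>\<open>power_le_imp_le_base\<close> has exponent \<open>Suc n\<close>, so the
    instance 2 takes cube roots.\<close>
  finally have "I \<le> ?B"
    by (rule power_le_imp_le_base[of _ 2, simplified]) simp
  moreover have "real (card (incidences \<delta> P L)) \<le> I"
    unfolding I_def M_def using P L by (intro card_incidences_le)
  ultimately show "real (card (incidences \<delta> P L)) \<le> ?B" by simp
qed simp

end
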